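(* Let $0\le p\le \tfrac12$. The $(\mathsf M,2)$ Scheme A with $S_1,\dots,S_{\mathsf M-1}$ i.i.d. $\mathrm{Bernoulli}(p)$ achieves rate $\mathsf R_{\mathsf A}$, upload cost $\mathsf U_{\mathsf A}$, access complexity $\Delta_{\mathsf A}$ and leakages $\rho_{\mathsf A}^{(\cdot)}$ given by $$\mathsf R_{\mathsf A}=\bigl(1-(1-p)^{\mathsf M-1}+1\bigr)^{-1},\qquad \mathsf U_{\mathsf A}=-\sum_{w=0}^{\mathsf M}\binom{\mathsf M}{w}f(w,p)\log_2 f(w,p),\qquad \Delta_{\mathsf A}=\sum_{w=0}^{\mathsf M}w\binom{\mathsf M}{w}f(w,p),$$ $$\rho^{(\mathsf{MI})}_{\mathsf A}=\frac{\mathsf U_{\mathsf A}}2-(\mathsf M-1)H_b(p),\qquad \rho^{(\mathsf{WIL})}_{\mathsf A}=\log_2\mathsf M-\min_{w\in\{0,\dots,\mathsf M\}}H(M_w),$$ $$\rho^{(\mathsf{MaxL})}_{\mathsf A}=\log_2\sum_{\substack{w\in\{1,\dots,\mathsf M\}\\ w\text{ odd}}}\binom{\mathsf M}{w}(1-p)^{\mathsf M-w}p^{w-1},$$ where $$f(w,p)=\frac1{\mathsf M}\Bigl((\mathsf M-w)(1-p)^{\mathsf M-w-1}p^w+w(1-p)^{\mathsf M-w}p^{w-1}\Bigr)$$ and $M_w$ is a random variable on $\{1,\dots,\mathsf M\}$ with $$P_{M_w}(m')=\begin{cases}\dfrac{(1-p)^{\mathsf M-w-1}p^w}{\mathsf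 M f(w,p)}& m'\in\{1,\dots,\mathsf M-w\},\\[2mm] \dfrac{(1-p)^{\mathsf M-w}p^{w-1}}{\mathsf M f(w,p)}& m'\in\{\mathsf M-w+1,\dots,\mathsf M\}.\end{cases}$$ (The minimum over $w$ is over those $w$ with $f(w,p)>0$.)
   Context: $H_b(p)=-p\log_2p-(1-p)\log_2(1-p)$; entropies in bits; $0\log_2 0=0$, $0^0=1$, and a term with prefactor $\mathsf M-w=0$ or $w=0$ is $0$. Setting: $2$ noncolluding servers each store the same $\mathsf M$ independent files. Scheme A with $n=2$ has file length $\beta=1$ over $\mathcal X=\{0,1\}$; each file is a uniform bit $X^{(m)}_1$, and $X^{(m)}_0:=0$. The requested index $M$ is uniform on $\{1,\dots,\mathsf M\}$, independent of the files. The user draws $S=(S_1,\dots,S_{\mathsf M-1})\in\{0,1\}^{\mathsf M-1}$ independently of $M$ and the files. If $M=m$ and $S=s$, the query to server $l\in\{1,2\}$ is $$q_l=(s_1,\dots,s_{m-1},q_{l,m},s_m,\dots,s_{\mathsf M-1}),\qquad q_{l,m}=\Bigl(l-1-\sum_{j=1}^{\mathsf M-1}s_j\Bigr)\bmod 2 .$$ Server $l$ answers $A_l=X^{(1)}_{q_{l,1}}+\dots+X^{(\mathsf M)}_{q_{l,\mathsf M}}$ (mod 2). The answer length is $\ell_l(q_l)=0$ if $q_l=0$ and $1$ otherwise; the number of accessed symbols $\delta_l(q_l)$ is the Hamming weight of $q_l$. $Q_l$ denotes the random query. Quantities: rate $\mathsf R=\beta\log_2|\mathcal X|\big/\bigl(\log_2|\mathcal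 A|\sum_l\mathbb E[\ell_l(Q_l)]\bigr)$ with $\mathcal A=\{0,1\}$; upload cost $\mathsf U=\sum_l H(Q_l)$; access complexity $\Delta=\sum_l\mathbb E[\delta_l(Q_l)]$. Leakages: $\rho^{(\mathsf{MI})}=\frac12\sum_l I(M;Q_l)$; $\rho^{(\mathsf{WIL})}=\max_l[H(M)-\min_{q}H(M\mid Q_l=q)]$ (min over $q$ with $P_{Q_l}(q)>0$); $\rho^{(\mathsf{MaxL})}=\max_l\log_2\sum_{q}\max_{m}P_{Q_l|M}(q|m)$. *)

theory Defs
  imports "HOL-Probability.Probability"
begin

text \<open>
  Entropies are in bits. Every random variable below is discrete, so its entropy is the
  differential entropy with respect to the counting measure; the usual sums are derived below.
\<close>

definition entropy_bits :: "'w pmf \<Rightarrow> ('w \<Rightarrow> 'a) \<Rightarrow> real" where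
  "entropy_bits P X = prob_space.entropy (measure_pmf P) 2 (count_space UNIV) X"

definition mutual_information_bits :: "'w pmf \<Rightarrow> ('w \<Rightarrow> 'a) \<Rightarrow> ('w \<Rightarrow> 'b) \<Rightarrow> real" where
  "mutual_information_bits P X Y =
     prob_space.mutual_information (measure_pmf P) 2 (count_space UNIV) (count_space UNIV) X Y"

lemma distributed_map_pmf: "distributed (measure_pmf P) (count_space UNIV) X (\<lambda>x. ennreal (pmf (map_pmf X P) x))"
  unfolding distributed_def
  by (auto simp: measure_pmf_eq_density[symmetric] map_pmf_rep_eq[symmetric])

lemma entropy_bits_eq_sum:
  fixes X :: "'w \<Rightarrow> 'b::countable"
  assumes "finite (set_pmf (map_pmf X P))"
  shows "entropy_bits P X = - (\<Sum>x\<in>set_pmf (map_pmf X P). pmf (map_pmf X P) x * log 2 (pmf (map_pmf X P) x))"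
proof -
  interpret information_space "measure_pmf P" 2 by unfold_locales auto
  have "entropy_bits P X = - (\<integral>x. pmf (map_pmf X P) x * log 2 (pmf (map_pmf X P) x) \<partial>count_space UNIV)"
    unfolding entropy_bits_def by (rule entropy_distr[OF distributed_map_pmf]) auto
  also have "(\<integral>x. pmf (map_pmf X P) x * log 2 (pmf (map_pmf X P) x) \<partial>count_space UNIV) = (\<Sum>x\<in>set_pmf (map_pmf X P). pmf (map_pmf X P) x * log 2 (pmf (map_pmf X P) x))"
    by (subst lebesgue_integral_count_space_finite_support)
       (use assms in \<open>auto simp: set_pmf_iff simp del: set_map_pmf intro!: sum.mono_neutral_left rev_finite_subset[OF assms]\<close>)
  finally show ?thesis .
qed

lemma mutual_information_bits_eq_sum:
  fixes X :: "'w \<Rightarrow> 'b::countable" and Y :: "'w \<Rightarrow> 'c::countable"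
  assumes "finite (set_pmf (map_pmf (\<lambda>w. (X w, Y w)) P))"
  shows "mutual_information_bits P X Y = (\<Sum>z\<in>set_pmf (map_pmf (\<lambda>w. (X w, Y w)) P). pmf (map_pmf (\<lambda>w. (X w, Y w)) P) z *
     log 2 (pmf (map_pmf (\<lambda>w. (X w, Y w)) P) z / (pmf (map_pmf X P) (fst z) * pmf (map_pmf Y P) (snd z))))"
proof -
  interpret information_space "measure_pmf P" 2 by unfold_locales auto
  let ?Z = "map_pmf (\<lambda>w. (X w, Y w)) P"
  have cs: "count_space UNIV \<Otimes>\<^sub>M count_space UNIV = (count_space UNIV :: ('b\<times>'c) measure)"
    by (simp add: pair_measure_countable)
  have s: "sigma_finite_measure (count_space (UNIV::'b set))" "sigma_finite_measure (count_space (UNIV::'c set))"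
    by (auto intro: sigma_finite_measure_count_space_countable)
  have "mutual_information_bits P X Y = (\<integral>z. pmf ?Z z * log 2 (pmf ?Z z / (pmf (map_pmf X P) (fst z) * pmf (map_pmf Y P) (snd z))) \<partial>(count_space UNIV \<Otimes>\<^sub>M count_space UNIV))"
    unfolding mutual_information_bits_def
    by (rule mutual_information_distr[OF s(1) s(2) distributed_map_pmf _ distributed_map_pmf _ ]) (auto simp: cs distributed_map_pmf)
  also have "\<dots> = (\<Sum>z\<in>set_pmf ?Z. pmf ?Z z *
     log 2 (pmf ?Z z / (pmf (map_pmf X P) (fst z) * pmf (map_pmf Y P) (snd z))))"
    unfolding cs
    by (subst lebesgue_integral_count_space_finite_support)
       (use assms in \<open>auto simp: set_pmf_iff simp del: set_map_pmf case_prod_beta intro!: sum.mono_neutral_left rev_finite_subset[OF assms]\<close>)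
  finally show ?thesis .
qed

text \<open>\<open>H(X | Y = y)\<close> for a fixed value \<open>y\<close> of positive probability.\<close>

definition entropy_given :: "'w pmf \<Rightarrow> ('w \<Rightarrow> 'a) \<Rightarrow> ('w \<Rightarrow> 'b) \<Rightarrow> 'b \<Rightarrow> real" where
  "entropy_given P X Y y = entropy_bits (cond_pmf P {\<omega>. Y \<omega> = y}) X"

definition binary_entropy :: "real \<Rightarrow> real" where
  "binary_entropy p = - p * log 2 p - (1 - p) * log 2 (1 - p)"


section \<open>Performance measures of a retrieval scheme\<close>

text \<open>
  \<open>L\<close> is the set of servers, \<open>Q l\<close> the random query to server \<open>l\<close> and \<open>W\<close> the random index of
  the requested file.
\<close>

definition rate ::
  "'l set \<Rightarrow> nat \<Rightarrow> 'x set \<Rightarrow> 'a set \<Rightarrow> 'w pmf \<Rightarrow> ('l \<Rightarrow> 'w \<Rightarrow> 'q) \<Rightarrow> ('l \<Rightarrow> 'q \<Rightarrow> nat) \<Rightarrow> real" where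
  "rate L \<beta> \<X> \<A> P Q len =
     real \<beta> * log 2 (real (card \<X>)) /
       (log 2 (real (card \<A>)) * (\<Sum>l\<in>L. measure_pmf.expectation P (\<lambda>\<omega>. real (len l (Q l \<omega>)))))"

definition upload_cost :: "'l set \<Rightarrow> 'w pmf \<Rightarrow> ('l \<Rightarrow> 'w \<Rightarrow> 'q) \<Rightarrow> real" where
  "upload_cost L P Q = (\<Sum>l\<in>L. entropy_bits P (Q l))"

definition access_complexity ::
  "'l set \<Rightarrow> 'w pmf \<Rightarrow> ('l \<Rightarrow> 'w \<Rightarrow> 'q) \<Rightarrow> ('l \<Rightarrow> 'q \<Rightarrow> nat) \<Rightarrow> real" where
  "access_complexity L P Q acc =
     (\<Sum>l\<in>L. measure_pmf.expectation P (\<lambda>\<omega>. real (acc l (Q l \<omega>))))"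

definition leakage_MI :: "'l set \<Rightarrow> 'w pmf \<Rightarrow> ('w \<Rightarrow> 'm) \<Rightarrow> ('l \<Rightarrow> 'w \<Rightarrow> 'q) \<Rightarrow> real" where
  "leakage_MI L P W Q = 1 / real (card L) * (\<Sum>l\<in>L. mutual_information_bits P W (Q l))"

definition leakage_WIL :: "'l set \<Rightarrow> 'w pmf \<Rightarrow> ('w \<Rightarrow> 'm) \<Rightarrow> ('l \<Rightarrow> 'w \<Rightarrow> 'q) \<Rightarrow> real" where
  "leakage_WIL L P W Q =
     (MAX l\<in>L. entropy_bits P W - (MIN q\<in>set_pmf (map_pmf (Q l) P). entropy_given P W (Q l) q))"

definition leakage_MaxL :: "'l set \<Rightarrow> 'w pmf \<Rightarrow> ('w \<Rightarrow> 'm) \<Rightarrow> ('l \<Rightarrow> 'w \<Rightarrow> 'q) \<Rightarrow> real" where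
  "leakage_MaxL L P W Q =
     (MAX l\<in>L. log 2 (\<Sum>q\<in>set_pmf (map_pmf (Q l) P).
        MAX m\<in>set_pmf (map_pmf W P). \<P>(\<omega> in measure_pmf P. Q l \<omega> = q \<bar> W \<omega> = m)))"


section \<open>Scheme A for two servers\<close>

text \<open>
  Bits are the natural numbers 0 and 1, and \<open>N\<close> is the number of files. Entry \<open>j\<close> of a vector
  (counted from 1) is entry \<open>j - 1\<close> of the list representing it.
\<close>

definition servers :: "nat set" where
  "servers = {1, 2}"

definition bits :: "nat set" where
  "bits = {0, 1}"

definition bit_pmf :: "real \<Rightarrow> nat pmf" where
  "bit_pmf p = map_pmf of_bool (bernoulli_pmf p)"

text \<open>
  An outcome consists of the files, the requested index and the random vector of the user. The
  latter may have any law \<open>PS\<close> on bit vectors of length \<open>N - 1\<close>.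
\<close>

type_synonym outcome = "nat list \<times> nat \<times> nat list"

definition scheme_space :: "nat \<Rightarrow> nat list pmf \<Rightarrow> outcome pmf" where
  "scheme_space N PS =
     pair_pmf (replicate_pmf N (bit_pmf (1 / 2))) (pair_pmf (pmf_of_set {1..N}) PS)"

definition files :: "outcome \<Rightarrow> nat list" where
  "files \<omega> = fst \<omega>"

definition index :: "outcome \<Rightarrow> nat" where
  "index \<omega> = fst (snd \<omega>)"

definition user_vector :: "outcome \<Rightarrow> nat list" where
  "user_vector \<omega> = snd (snd \<omega>)"

definition query_symbol :: "nat \<Rightarrow> nat list \<Rightarrow> nat" where
  "query_symbol l s = nat ((int l - 1 - int (sum_list s)) mod 2)"

definition query_vector :: "nat \<Rightarrow> nat \<Rightarrow> nat list \<Rightarrow> nat list" where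
  "query_vector l m s = take (m - 1) s @ [query_symbol l s] @ drop (m - 1) s"

definition query :: "nat \<Rightarrow> outcome \<Rightarrow> nat list" where
  "query l \<omega> = query_vector l (index \<omega>) (user_vector \<omega>)"

text \<open>Symbol \<open>i\<close> of file \<open>m\<close>: symbol 1 is the stored bit and symbol 0 is the constant 0.\<close>

definition file_symbol :: "nat list \<Rightarrow> nat \<Rightarrow> nat \<Rightarrow> nat" where
  "file_symbol x m i = (if i = 0 then 0 else x ! (m - 1))"

definition answer :: "nat list \<Rightarrow> nat list \<Rightarrow> nat" where
  "answer x q = (\<Sum>m = 1..length x. file_symbol x m (q ! (m - 1))) mod 2"

definition answer_length :: "nat \<Rightarrow> nat list \<Rightarrow> nat" where
  "answer_length l q = (if q = replicate (length q) 0 then 0 else 1)"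

definition accessed_symbols :: "nat \<Rightarrow> nat list \<Rightarrow> nat" where
  "accessed_symbols l q = card {j. j < length q \<and> q ! j \<noteq> 0}"

text \<open>
  The performance measures do not involve the answers. The next two facts justify that no symbol is
  sent for the zero query, and show that the two answers determine the requested file.
\<close>

lemma answer_query_zero: "answer x (replicate (length x) 0) = 0"
proof -
  have "(\<Sum>m = 1..length x. file_symbol x m (replicate (length x) 0 ! (m - 1))) = 0"
    by (rule sum.neutral) (auto simp: file_symbol_def)
  then show ?thesis
    by (simp add: answer_def)
qed

lemma scheme_decodes:
  assumes x: "set x \<subseteq> bits" and m: "1 \<le> m" "m \<le> length x"
    and s: "length s = length x - 1"
  shows "(answer x (query_vector 1 m s) + answer x (query_vector 2 m s)) mod 2
           = file_symbol x m 1"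
proof -
  let ?F = "\<lambda>l k. file_symbol x k (query_vector l m s ! (k - 1))"
  have other: "query_vector 1 m s ! (k - 1) = query_vector 2 m s ! (k - 1)"
    if "k \<in> {1..length x} - {m}" for k
    using that m s by (auto simp: query_vector_def nth_append nth_Cons split: nat.split)
  have this_file: "query_vector l m s ! (m - 1) = query_symbol l s" for l
    using m s by (simp add: query_vector_def nth_append)
  have sym: "query_symbol 1 s = 0 \<and> query_symbol 2 s = 1
      \<or> query_symbol 1 s = 1 \<and> query_symbol 2 s = 0"
  proof -
    have "(- i) mod 2 = 0 \<and> (1 - i) mod 2 = 1 \<or> (- i) mod 2 = 1 \<and> (1 - i) mod 2 = 0" for i :: int
      by presburger
    from this[of "int (sum_list s)"] show ?thesis
      by (auto simp: query_symbol_def)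
  qed
  have split: "(\<Sum>k = 1..length x. ?F l k)
      = ?F l m + (\<Sum>k\<in>{1..length x} - {m}. ?F l k)" for l
    by (rule sum.remove) (use m in auto)
  have eq: "(\<Sum>k\<in>{1..length x} - {m}. ?F 1 k) = (\<Sum>k\<in>{1..length x} - {m}. ?F 2 k)"
    by (rule sum.cong) (use other in auto)
  have "x ! (m - 1) \<in> bits"
    using x m by (auto intro!: nth_mem subsetD[OF x])
  then have bit: "x ! (m - 1) < 2"
    by (auto simp: bits_def)
  have "?F 1 m + ?F 2 m = file_symbol x m 1"
    unfolding this_file using sym by (auto simp: file_symbol_def)
  then have "(\<Sum>k = 1..length x. ?F 1 k) + (\<Sum>k = 1..length x. ?F 2 k)
      = file_symbol x m 1 + 2 * (\<Sum>k\<in>{1..length x} - {m}. ?F 2 k)"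
    unfolding split eq by simp
  then show ?thesis
    using bit by (simp add: answer_def mod_add_eq file_symbol_def)
qed


section \<open>Closed forms\<close>

text \<open>
  At \<open>w = N\<close> and \<open>w = 0\<close> the truncated exponents \<open>N - w - 1\<close> and \<open>w - 1\<close> only occur
  with the prefactor 0.
\<close>

definition query_prob :: "nat \<Rightarrow> nat \<Rightarrow> real \<Rightarrow> real" where
  "query_prob N w p = 1 / real N *
     (real (N - w) * (1 - p) ^ (N - w - 1) * p ^ w + real w * (1 - p) ^ (N - w) * p ^ (w - 1))"

text \<open>
  The law of the index given a query of weight \<open>w\<close>, up to a permutation of the indices; it is a
  probability mass function when \<open>query_prob N w p > 0\<close>.
\<close>

definition index_law :: "nat \<Rightarrow> nat \<Rightarrow> real \<Rightarrow> nat pmf" where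
  "index_law N w p = embed_pmf (\<lambda>m.
     if m \<in> {1..N - w} then (1 - p) ^ (N - w - 1) * p ^ w / (real N * query_prob N w p)
     else if m \<in> {N - w + 1..N} then (1 - p) ^ (N - w) * p ^ (w - 1) / (real N * query_prob N w p)
     else 0)"

lemma pmf_index_law:
  assumes "0 \<le> p" "p \<le> 1" "w \<le> N" and pos: "query_prob N w p > 0"
  shows "pmf (index_law N w p) m =
    (if m \<in> {1..N - w} then (1 - p) ^ (N - w - 1) * p ^ w / (real N * query_prob N w p)
     else if m \<in> {N - w + 1..N} then (1 - p) ^ (N - w) * p ^ (w - 1) / (real N * query_prob N w p)
     else 0)"
proof -
  let ?a = "(1 - p) ^ (N - w - 1) * p ^ w / (real N * query_prob N w p)"
  let ?b = "(1 - p) ^ (N - w) * p ^ (w - 1) / (real N * query_prob N w p)"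
  let ?g = "\<lambda>m. if m \<in> {1..N - w} then ?a else if m \<in> {N - w + 1..N} then ?b else 0"
  have N: "0 < N"
    using pos by (auto simp: query_prob_def intro: gr0I)
  have nonneg: "0 \<le> ?g m" for m
    using assms by simp
  have union: "{1..N} = {1..N - w} \<union> {N - w + 1..N}"
    using assms by auto
  have "(\<Sum>m\<in>{1..N}. ?g m) = (\<Sum>m\<in>{1..N - w}. ?g m) + (\<Sum>m\<in>{N - w + 1..N}. ?g m)"
    unfolding union by (rule sum.union_disjoint) auto
  also have "(\<Sum>m\<in>{1..N - w}. ?g m) = real (N - w) * ?a"
    by simp
  also have "(\<Sum>m\<in>{N - w + 1..N}. ?g m) = (\<Sum>m\<in>{N - w + 1..N}. ?b)"
    by (rule sum.cong) auto
  also have "\<dots> = real w * ?b"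
    using assms by simp
  also have "real (N - w) * ?a + real w * ?b
      = (real N * query_prob N w p) / (real N * query_prob N w p)"
  proof -
    have "real N * query_prob N w p =
        real (N - w) * ((1 - p) ^ (N - w - 1) * p ^ w) + real w * ((1 - p) ^ (N - w) * p ^ (w - 1))"
      using N by (simp add: query_prob_def)
    then show ?thesis
      by (simp only: times_divide_eq_right add_divide_distrib)
  qed
  also have "\<dots> = 1"
    using N pos by simp
  finally have total: "(\<Sum>m\<in>{1..N}. ?g m) = 1" .
  have "(\<integral>\<^sup>+m. ennreal (?g m) \<partial>count_space UNIV) = (\<Sum>m\<in>{1..N}. ennreal (?g m))"
    by (rule nn_integral_count_space') (use assms in auto)
  also have "\<dots> = ennreal (\<Sum>m\<in>{1..N}. ?g m)"
    by (rule sum_ennreal) (rule nonneg)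
  finally have "(\<integral>\<^sup>+m. ennreal (?g m) \<partial>count_space UNIV) = 1"
    unfolding total by simp
  from pmf_embed_pmf[OF nonneg this, of m] show ?thesis
    unfolding index_law_def .
qed

end

theory Submission
  imports Defs
begin

text \<open>
  Given the index \<open>m\<close>, the query to server \<open>l\<close> is the random vector with one entry inserted at
  position \<open>m\<close> so that the weight gets the parity of \<open>l - 1\<close>. This insertion is a bijection onto the
  bit vectors of that parity, so the conditional law of the query depends on the query only through
  its weight \<open>w\<close> and its entry at \<open>m\<close>, and averaging over \<open>m\<close> gives \<open>query_prob N w p\<close>. The supports
  of the two servers partition all bit vectors by parity, which turns sums over servers and queries
  into binomial sums over weights. Given \<open>m\<close>, the query has the entropy of \<open>N - 1\<close> Bernoulli bits,
  whence the mutual information. Since \<open>p \<le> 1 / 2\<close>, the likeliest index for a nonzero query has entry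
  1, and expanding \<open>(1 - 2 * p) ^ N\<close> shows that the odd-weight server leaks the most.
\<close>

section \<open>Bit vectors and sums over them by weight\<close>

definition bit_vectors :: "nat \<Rightarrow> nat list set" where
  "bit_vectors n = {q. set q \<subseteq> {0, 1} \<and> length q = n}"

lemma finite_bit_vectors [simp]: "finite (bit_vectors n)"
  unfolding bit_vectors_def by (rule finite_lists_length_eq) simp

lemma bit_vectors_0 [simp]: "bit_vectors 0 = {[]}"
  by (auto simp: bit_vectors_def)

lemma bit_vectors_Suc:
  "bit_vectors (Suc n) = Cons 0 ` bit_vectors n \<union> Cons 1 ` bit_vectors n"
  by (auto simp: bit_vectors_def length_Suc_conv image_iff)

lemma sum_list_bits_le: "set q \<subseteq> {0, 1 :: nat} \<Longrightarrow> sum_list q \<le> length q"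
  by (induction q) auto

text \<open>A zero entry rules out full weight. This later excludes the junk value of
  \<open>weight_prob\<close> at weight \<open>N\<close> and entry 0.\<close>

lemma sum_list_bits_less:
  assumes "set q \<subseteq> {0, 1 :: nat}" "j < length q" "q ! j = 0"
  shows "sum_list q < length q"
  using assms
proof (induction q arbitrary: j)
  case (Cons x q)
  show ?case
  proof (cases j)
    case 0
    with Cons.prems sum_list_bits_le[of q] show ?thesis by auto
  next
    case (Suc i)
    with Cons.prems have "sum_list q < length q"
      by (intro Cons.IH[of i]) auto
    with Cons.prems(1) show ?thesis by auto
  qed
qed simp

lemma sum_list_bit_vector_le: "q \<in> bit_vectors n \<Longrightarrow> sum_list q \<le> n"
  using sum_list_bits_le by (auto simp: bit_vectors_def)

lemma sum_bit_vectors_Suc: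
  fixes g :: "nat list \<Rightarrow> real"
  shows "(\<Sum>q\<in>bit_vectors (Suc n). g q)
    = (\<Sum>q\<in>bit_vectors n. g (0 # q)) + (\<Sum>q\<in>bit_vectors n. g (1 # q))"
  unfolding bit_vectors_Suc
  by (subst sum.union_disjoint) (auto simp: sum.reindex)

text \<open>Splitting off the first bit mirrors Pascal's rule. A leading 1 shifts the weight, so the
  induction must also apply to the shifted function and \<open>g\<close> stays arbitrary.\<close>

lemma sum_bit_vectors_weight:
  fixes g :: "nat \<Rightarrow> real"
  shows "(\<Sum>q\<in>bit_vectors n. g (sum_list q)) = (\<Sum>w = 0..n. real (n choose w) * g w)"
proof (induction n arbitrary: g)
  case 0
  show ?case by simp
next
  case (Suc n)
  have Suc_sum: "(\<Sum>w = 0..Suc n. h w) = h 0 + (\<Sum>w = 0..n. h (Suc w))" for h :: "nat \<Rightarrow> real"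
    by (rule sum.atLeast0_atMost_Suc_shift[unfolded comp_def])
  have "(\<Sum>w = 0..Suc n. real (Suc n choose w) * g w)
      = (g 0 + (\<Sum>w = 0..n. real (n choose Suc w) * g (Suc w))) + (\<Sum>w = 0..n. real (n choose w) * g (Suc w))"
    unfolding Suc_sum by (simp add: algebra_simps sum.distrib)
  also have "g 0 + (\<Sum>w = 0..n. real (n choose Suc w) * g (Suc w)) = (\<Sum>w = 0..Suc n. real (n choose w) * g w)"
    unfolding Suc_sum by simp
  also have "\<dots> = (\<Sum>w = 0..n. real (n choose w) * g w)"
    by simp
  finally show ?case
    by (simp only: sum_bit_vectors_Suc sum_list.Cons add_0 plus_1_eq_Suc
        Suc.IH[of g] Suc.IH[of "\<lambda>w. g (Suc w)"])
qed

text \<open>Only the numbers of zeros and ones matter. This makes sums over the requested index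
  depend on a query through its weight alone.\<close>

lemma sum_over_bits:
  fixes h :: "nat \<Rightarrow> real"
  assumes "set q \<subseteq> {0, 1}"
  shows "(\<Sum>m = 1..length q. h (q ! (m - 1)))
    = real (length q - sum_list q) * h 0 + real (sum_list q) * h 1"
proof -
  have "(\<Sum>m = 1..length q. h (q ! (m - 1))) = (\<Sum>j = 0..<length q. h (q ! j))"
    by (rule sum.reindex_bij_witness[of _ Suc "\<lambda>m. m - 1"]) auto
  also have "\<dots> = sum_list (map h q)"
    by (simp add: sum_list_sum_nth)
  also have "\<dots> = real (length q - sum_list q) * h 0 + real (sum_list q) * h 1"
    using assms
  proof (induction q)
    case (Cons x q)
    then have "sum_list q \<le> length q"
      using sum_list_bits_le by simp
    with Cons show ?case
      by (auto simp: Suc_diff_le algebra_simps)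
  qed simp
  finally show ?thesis .
qed

section \<open>The law of a Bernoulli vector\<close>

lemma pmf_bit_pmf:
  assumes "0 \<le> p" "p \<le> 1"
  shows "pmf (bit_pmf p) 0 = 1 - p" "pmf (bit_pmf p) (Suc 0) = p"
proof -
  have inj: "inj (of_bool :: bool \<Rightarrow> nat)"
    by (auto simp: inj_def split: bool.splits)
  show "pmf (bit_pmf p) 0 = 1 - p" "pmf (bit_pmf p) (Suc 0) = p"
    using pmf_map_inj'[OF inj, of "bernoulli_pmf p" False] pmf_map_inj'[OF inj, of "bernoulli_pmf p" True] assms
    by (auto simp: bit_pmf_def)
qed

lemma pmf_replicate_Cons:
  "pmf (replicate_pmf (Suc n) R) (x # xs) = pmf R x * pmf (replicate_pmf n R) xs"
proof -
  have "replicate_pmf (Suc n) R = map_pmf (\<lambda>(x, xs). x # xs) (pair_pmf R (replicate_pmf n R))"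
    by (simp add: pair_pmf_def map_bind_pmf)
  moreover have "inj (\<lambda>(x, xs). x # xs)"
    by (auto simp: inj_def)
  ultimately show ?thesis
    using pmf_map_inj'[of "\<lambda>(x, xs). x # xs" "pair_pmf R (replicate_pmf n R)" "(x, xs)"]
    by (simp add: pmf_pair)
qed

lemma set_replicate_bit_pmf: "set_pmf (replicate_pmf n (bit_pmf p)) \<subseteq> bit_vectors n"
  by (force simp: set_replicate_pmf bit_vectors_def bit_pmf_def)

lemma pmf_replicate_bit_pmf:
  assumes "0 \<le> p" "p \<le> 1" "s \<in> bit_vectors n"
  shows "pmf (replicate_pmf n (bit_pmf p)) s = (1 - p) ^ (n - sum_list s) * p ^ sum_list s"
  using assms(3)
proof (induction n arbitrary: s)
  case 0
  then show ?case by simp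
next
  case (Suc n)
  then obtain x t where s: "s = x # t" "x \<in> {0, 1}" "t \<in> bit_vectors n"
    by (auto simp: bit_vectors_def length_Suc_conv)
  with sum_list_bit_vector_le Suc.IH[OF s(3)] show ?case
    by (auto simp: pmf_replicate_Cons pmf_bit_pmf[OF assms(1,2)] Suc_diff_le simp del: replicate_pmf.simps)
qed

section \<open>Entropy through x log x\<close>

definition xlog2 :: "real \<Rightarrow> real" where
  "xlog2 x = x * log 2 x"

lemma xlog2_0 [simp]: "xlog2 0 = 0"
  by (simp add: xlog2_def)

text \<open>A Leibniz rule. If a factor is 0, both sides vanish, so zero probabilities need no
  separate treatment later.\<close>

lemma xlog2_mult:
  assumes "0 \<le> x" "0 \<le> y"
  shows "xlog2 (x * y) = xlog2 x * y + x * xlog2 y"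
  using assms by (cases "x = 0 \<or> y = 0") (auto simp: xlog2_def log_mult algebra_simps)

text \<open>Additivity of entropy over independent bits: by the Leibniz rule and total mass 1, each
  further bit contributes \<open>xlog2 (1 - p) + xlog2 p\<close>.\<close>

lemma sum_xlog2_replicate_bit_pmf:
  assumes "0 \<le> p" "p \<le> 1"
  shows "(\<Sum>s\<in>bit_vectors n. xlog2 (pmf (replicate_pmf n (bit_pmf p)) s)) = - real n * binary_entropy p"
proof (induction n)
  case 0
  show ?case by (simp add: xlog2_def)
next
  case (Suc n)
  let ?r = "pmf (replicate_pmf n (bit_pmf p))"
  have total: "(\<Sum>s\<in>bit_vectors n. ?r s) = 1"
    using set_replicate_bit_pmf by (intro sum_pmf_eq_1) auto
  have "(\<Sum>s\<in>bit_vectors n. xlog2 (c * ?r s)) = xlog2 c + c * (- real n * binary_entropy p)"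
    if "0 \<le> c" for c
    using that by (simp add: xlog2_mult sum.distrib total Suc.IH flip: sum_distrib_left)
  from this[of p] this[of "1 - p"] assms
  have "(\<Sum>s\<in>bit_vectors n. xlog2 ((1 - p) * ?r s)) + (\<Sum>s\<in>bit_vectors n. xlog2 (p * ?r s))
      = xlog2 (1 - p) + xlog2 p - real n * binary_entropy p"
    by (simp add: algebra_simps)
  also have "xlog2 (1 - p) + xlog2 p = - binary_entropy p"
    by (simp add: xlog2_def binary_entropy_def)
  finally show ?case
    by (simp add: sum_bit_vectors_Suc pmf_replicate_Cons pmf_bit_pmf[OF assms] algebra_simps del: replicate_pmf.simps)
qed

lemma entropy_bits_eq_xlog2:
  fixes X :: "'w \<Rightarrow> 'b::countable"
  assumes "finite A" "set_pmf (map_pmf X P) \<subseteq> A"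
  shows "entropy_bits P X = - (\<Sum>x\<in>A. xlog2 (pmf (map_pmf X P) x))"
proof -
  have "entropy_bits P X = - (\<Sum>x\<in>set_pmf (map_pmf X P). xlog2 (pmf (map_pmf X P) x))"
    unfolding xlog2_def by (rule entropy_bits_eq_sum) (rule finite_subset[OF assms(2,1)])
  also have "(\<Sum>x\<in>set_pmf (map_pmf X P). xlog2 (pmf (map_pmf X P) x)) = (\<Sum>x\<in>A. xlog2 (pmf (map_pmf X P) x))"
    using assms by (intro sum.mono_neutral_left) (auto simp: set_pmf_iff simp del: set_map_pmf)
  finally show ?thesis .
qed

section \<open>Point masses of image laws\<close>

lemma pmf_map_pair_dependent:
  fixes A :: "'a::countable pmf" and B :: "'b::countable pmf"
  shows "pmf (map_pmf (\<lambda>(a, b). (a, f a b)) (pair_pmf A B)) (a, c) = pmf A a * pmf (map_pmf (f a) B) c"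
proof -
  have "(\<lambda>(a, b). (a, f a b)) -` {(a, c)} = {a} \<times> (f a -` {c})"
    by auto
  then show ?thesis
    by (simp add: pmf_map measure_pmf_prob_product measure_pmf_single)
qed

text \<open>The point may lie outside the support as long as it is in \<open>A\<close>; this covers
  the vectors of probability 0 that occur at p = 0.\<close>

lemma pmf_map_inj_on:
  assumes "inj_on f A" "set_pmf R \<subseteq> A" "x \<in> A"
  shows "pmf (map_pmf f R) (f x) = pmf R x"
proof (cases "x \<in> set_pmf R")
  case True
  then show ?thesis
    using assms by (intro pmf_map_inj) (auto intro: inj_on_subset)
next
  case False
  then have "f x \<notin> f ` set_pmf R"
    using assms by (auto dest: inj_onD)
  with False show ?thesis
    by (simp add: pmf_map_outside set_pmf_iff)
qed

section \<open>Queries as insertion of a parity symbol\<close>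

lemma query_symbol_bit: "query_symbol l s \<in> {0, 1}"
proof -
  have "i mod 2 = 0 \<or> i mod 2 = 1" for i :: int
    by presburger
  from this[of "int l - 1 - int (sum_list s)"] show ?thesis
    by (auto simp: query_symbol_def)
qed

text \<open>The inserted symbol gives the query a weight congruent to \<open>l - 1\<close> modulo 2.
  Oddness of the sum with \<open>l\<close> says this without subtraction.\<close>

lemma odd_query_symbol: "odd (sum_list s + query_symbol l s + l)"
proof -
  let ?i = "int l - 1 - int (sum_list s)"
  have "int (query_symbol l s) = ?i mod 2"
    by (simp add: query_symbol_def)
  then have "int (sum_list s + query_symbol l s + l) = int (sum_list s) + ?i mod 2 + int l"
    by simp
  moreover have "odd (int (sum_list s) + ?i mod 2 + int l)"
    by presburger
  ultimately show ?thesis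
    by presburger
qed

lemma query_symbol_unique:
  assumes "x \<in> {0, 1}" "odd (sum_list s + x + l)"
  shows "query_symbol l s = x"
  using assms query_symbol_bit[of l s] odd_query_symbol[of s l] by auto

lemma query_vector_props:
  assumes "m \<in> {1..N}" "s \<in> bit_vectors (N - 1)"
  shows nth_query_vector: "query_vector l m s ! (m - 1) = query_symbol l s"
    and sum_list_query_vector: "sum_list (query_vector l m s) = sum_list s + query_symbol l s"
proof -
  have "length (take (m - 1) s) = m - 1"
    using assms by (auto simp: bit_vectors_def)
  then show "query_vector l m s ! (m - 1) = query_symbol l s"
    by (simp only: query_vector_def nth_append) simp
  have "sum_list s = sum_list (take (m - 1) s @ drop (m - 1) s)"
    by (simp only: append_take_drop_id)
  then show "sum_list (query_vector l m s) = sum_list s + query_symbol l s"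
    unfolding query_vector_def sum_list_append by simp
qed

text \<open>The vectors of weight congruent to \<open>l - 1\<close> modulo 2: even weights for
  server 1, odd ones for server 2. It may exceed the support of the query, since some of these
  vectors can have probability 0.\<close>

definition query_set :: "nat \<Rightarrow> nat \<Rightarrow> nat list set" where
  "query_set N l = {q \<in> bit_vectors N. odd (sum_list q + l)}"

lemma finite_query_set [simp]: "finite (query_set N l)"
  by (simp add: query_set_def)

lemma query_vector_in_query_set:
  assumes "m \<in> {1..N}" "s \<in> bit_vectors (N - 1)"
  shows "query_vector l m s \<in> query_set N l"
proof -
  have "set (query_vector l m s) \<subseteq> {0, 1}"
    using assms query_symbol_bit[of l s] set_take_subset[of "m - 1" s] set_drop_subset[of "m - 1" s]
    by (auto simp: query_vector_def bit_vectors_def)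
  moreover have "length (query_vector l m s) = N"
    using assms by (auto simp: query_vector_def bit_vectors_def)
  ultimately show ?thesis
    using odd_query_symbol[of s l] sum_list_query_vector[OF assms]
    by (simp add: query_set_def bit_vectors_def)
qed

lemma split_at_entry:
  assumes "m \<in> {1..length q}"
  shows "q = take (m - 1) q @ q ! (m - 1) # drop m q"
proof -
  have "m - 1 < length q" "Suc (m - 1) = m"
    using assms by auto
  with id_take_nth_drop[of "m - 1" q] show ?thesis
    by metis
qed

text \<open>The inverse deletes the entry at position \<open>m\<close>; nothing is lost, because the
  parity of the whole query determines the deleted bit.\<close>

lemma bij_query_vector:
  assumes m: "m \<in> {1..N}"
  shows "bij_betw (query_vector l m) (bit_vectors (N - 1)) (query_set N l)"
proof (rule bij_betw_byWitness[where f' = "\<lambda>q. take (m - 1) q @ drop m q"])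
  show "\<forall>s\<in>bit_vectors (N - 1). take (m - 1) (query_vector l m s) @ drop m (query_vector l m s) = s"
  proof
    fix s assume "s \<in> bit_vectors (N - 1)"
    then have "length (take (m - 1) s) = m - 1"
      using m by (auto simp: bit_vectors_def)
    then show "take (m - 1) (query_vector l m s) @ drop m (query_vector l m s) = s"
      using m by (cases m) (simp_all add: query_vector_def)
  qed
  show "\<forall>q\<in>query_set N l. query_vector l m (take (m - 1) q @ drop m q) = q"
  proof
    fix q assume q: "q \<in> query_set N l"
    then have len: "m - 1 < length q" and m': "m \<in> {1..length q}"
      using m by (auto simp: query_set_def bit_vectors_def)
    note split = split_at_entry[OF m']
    \<comment> \<open>The remaining weight plus the deleted bit has the parity prescribed for server
      \<open>l\<close>, so \<open>query_symbol_unique\<close> identifies the bit.\<close>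
    have "sum_list q = sum_list (take (m - 1) q @ drop m q) + q ! (m - 1)"
      by (subst split) simp
    moreover have "q ! (m - 1) \<in> {0, 1}"
      using q nth_mem[OF len] by (auto simp: query_set_def bit_vectors_def)
    ultimately have "query_symbol l (take (m - 1) q @ drop m q) = q ! (m - 1)"
      using q by (intro query_symbol_unique) (auto simp: query_set_def)
    then show "query_vector l m (take (m - 1) q @ drop m q) = q"
      using len split by (simp add: query_vector_def min_absorb1)
  qed
  show "query_vector l m ` bit_vectors (N - 1) \<subseteq> query_set N l"
    using query_vector_in_query_set[OF m] by auto
  show "(\<lambda>q. take (m - 1) q @ drop m q) ` query_set N l \<subseteq> bit_vectors (N - 1)"
    using m by (auto simp: query_set_def bit_vectors_def dest!: in_set_takeD in_set_dropD)
qed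

lemma sum_servers_query_set:
  fixes g :: "nat list \<Rightarrow> real"
  shows "(\<Sum>l\<in>servers. \<Sum>q\<in>query_set N l. g q) = (\<Sum>q\<in>bit_vectors N. g q)"
proof -
  have "bit_vectors N = query_set N 1 \<union> query_set N 2"
    by (auto simp: query_set_def)
  moreover have "query_set N 1 \<inter> query_set N 2 = {}"
    by (auto simp: query_set_def)
  ultimately show ?thesis
    by (simp add: servers_def sum.union_disjoint)
qed

lemma accessed_symbols_eq:
  assumes "set q \<subseteq> {0, 1}"
  shows "accessed_symbols l q = sum_list q"
proof -
  have "accessed_symbols l q = (\<Sum>j | j < length q \<and> q ! j \<noteq> 0. 1)"
    by (simp add: accessed_symbols_def)
  also have "\<dots> = (\<Sum>j | j < length q \<and> q ! j \<noteq> 0. q ! j)"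
    using assms by (intro sum.cong) (auto dest!: nth_mem)
  also have "\<dots> = (\<Sum>j = 0..<length q. q ! j)"
    by (rule sum.mono_neutral_left) auto
  also have "\<dots> = sum_list q"
    by (simp add: sum_list_sum_nth)
  finally show ?thesis .
qed

lemma sum_list_eq_0_iff_replicate: "sum_list q = 0 \<longleftrightarrow> q = replicate (length q) (0 :: nat)"
  by (induction q) auto

lemma answer_length_eq:
  "answer_length l q = (if sum_list q = 0 then 0 else 1)"
  unfolding answer_length_def by (subst sum_list_eq_0_iff_replicate) simp

section \<open>The joint law of index and query\<close>

locale bernoulli_scheme =
  fixes N :: nat and p :: real
  assumes N_pos: "1 \<le> N" and p_nonneg: "0 \<le> p" and p_le_half: "p \<le> 1 / 2"
begin

lemma p_le_1: "p \<le> 1"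
  using p_le_half by simp

definition vector_law :: "nat list pmf" where
  "vector_law = replicate_pmf (N - 1) (bit_pmf p)"

definition outcome_law :: "outcome pmf" where
  "outcome_law = scheme_space N vector_law"

text \<open>The law of the query given index \<open>m\<close>, written as an image law to avoid
  conditioning on an event; \<open>cond_prob_query\<close> makes the identification for
  \<open>m\<close> in \<open>{1..N}\<close>.\<close>

definition cond_law :: "nat \<Rightarrow> nat \<Rightarrow> nat list pmf" where
  "cond_law l m = map_pmf (query_vector l m) vector_law"

text \<open>
  The probability, given the index, of a query of weight \<open>w\<close> with entry \<open>b\<close> at the index. At
  \<open>w = N\<close>, \<open>b = 0\<close> and at \<open>w = 0\<close>, \<open>b = 1\<close>, where no such query exists, it is a junk value.
\<close>

definition weight_prob :: "nat \<Rightarrow> nat \<Rightarrow> real" where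
  "weight_prob w b = (if b = 0 then (1 - p) ^ (N - w - 1) * p ^ w else (1 - p) ^ (N - w) * p ^ (w - 1))"

lemma set_vector_law: "set_pmf vector_law \<subseteq> bit_vectors (N - 1)"
  unfolding vector_law_def by (rule set_replicate_bit_pmf)

lemma pmf_cond_law_query_vector:
  assumes "m \<in> {1..N}" "s \<in> bit_vectors (N - 1)"
  shows "pmf (cond_law l m) (query_vector l m s) = pmf vector_law s"
  unfolding cond_law_def
  by (rule pmf_map_inj_on[OF bij_betw_imp_inj_on[OF bij_query_vector[OF assms(1)]] set_vector_law assms(2)])

text \<open>The user vector behind \<open>q\<close> is \<open>q\<close> without its entry at
  \<open>m\<close>. Its weight is that of \<open>q\<close> lowered by this entry, which yields the
  two cases of \<open>weight_prob\<close>.\<close>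

lemma pmf_cond_law:
  assumes m: "m \<in> {1..N}" and q: "q \<in> query_set N l"
  shows "pmf (cond_law l m) q = weight_prob (sum_list q) (q ! (m - 1))"
proof -
  obtain s where s: "s \<in> bit_vectors (N - 1)" "q = query_vector l m s"
    using q bij_betw_imp_surj_on[OF bij_query_vector[OF m, of l]] by auto
  have "pmf (cond_law l m) q = (1 - p) ^ (N - 1 - sum_list s) * p ^ sum_list s"
    unfolding s(2) pmf_cond_law_query_vector[OF m s(1)]
    unfolding vector_law_def by (rule pmf_replicate_bit_pmf[OF p_nonneg p_le_1 s(1)])
  then show ?thesis
    using query_symbol_bit[of l s] query_vector_props[OF m s(1), of l] s(2)
    by (auto simp: weight_prob_def)
qed

lemma set_cond_law:
  assumes "m \<in> {1..N}"
  shows "set_pmf (cond_law l m) \<subseteq> query_set N l"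
  using query_vector_in_query_set[OF assms] set_vector_law by (auto simp: cond_law_def)

lemma map_index: "map_pmf index outcome_law = pmf_of_set {1..N}"
proof -
  have "map_pmf index outcome_law = map_pmf fst (map_pmf snd outcome_law)"
    by (simp add: map_pmf_comp index_def[abs_def])
  then show ?thesis
    by (simp add: outcome_law_def scheme_space_def map_snd_pair_pmf map_fst_pair_pmf)
qed

lemma pmf_index: "m \<in> {1..N} \<Longrightarrow> pmf (map_pmf index outcome_law) m = 1 / real N"
  unfolding map_index by simp

lemma set_index: "set_pmf (map_pmf index outcome_law) = {1..N}"
  unfolding map_index using N_pos by (simp add: set_pmf_of_set)

lemma map_index_query:
  "map_pmf (\<lambda>\<omega>. (index \<omega>, query l \<omega>)) outcome_law
    = map_pmf (\<lambda>(m, s). (m, query_vector l m s)) (pair_pmf (pmf_of_set {1..N}) vector_law)"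
proof -
  have "map_pmf (\<lambda>\<omega>. (index \<omega>, query l \<omega>)) outcome_law
      = map_pmf (\<lambda>(m, s). (m, query_vector l m s)) (map_pmf snd outcome_law)"
    by (simp add: map_pmf_comp index_def query_def user_vector_def case_prod_beta)
  then show ?thesis
    by (simp add: outcome_law_def scheme_space_def map_snd_pair_pmf)
qed

lemma pmf_index_query:
  assumes "m \<in> {1..N}"
  shows "pmf (map_pmf (\<lambda>\<omega>. (index \<omega>, query l \<omega>)) outcome_law) (m, q) = pmf (cond_law l m) q / real N"
  using assms unfolding map_index_query pmf_map_pair_dependent
  by (simp add: cond_law_def)

lemma map_query: "map_pmf (query l) outcome_law = pmf_of_set {1..N} \<bind> cond_law l"
proof -
  have "map_pmf (query l) outcome_law = map_pmf snd (map_pmf (\<lambda>\<omega>. (index \<omega>, query l \<omega>)) outcome_law)"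
    by (simp add: map_pmf_comp)
  then show ?thesis
    unfolding map_index_query
    by (simp add: map_pmf_comp pair_pmf_def map_bind_pmf case_prod_beta cond_law_def[abs_def] map_pmf_def)
       (simp add: bind_assoc_pmf bind_return_pmf)
qed

lemma pmf_query_eq_average:
  "pmf (map_pmf (query l) outcome_law) q = (\<Sum>m = 1..N. pmf (cond_law l m) q) / real N"
  unfolding map_query using N_pos by (subst pmf_bind_pmf_of_set) auto

text \<open>In the average over \<open>m\<close>, a query of weight w meets entry 0 at N - w indices
  and entry 1 at w indices; these are the two terms of \<open>query_prob\<close>.\<close>

lemma pmf_query:
  assumes q: "q \<in> query_set N l"
  shows "pmf (map_pmf (query l) outcome_law) q = query_prob N (sum_list q) p"
proof -
  have "length q = N" "set q \<subseteq> {0, 1}"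
    using q by (auto simp: query_set_def bit_vectors_def)
  with sum_over_bits[of q "weight_prob (sum_list q)"]
  have "(\<Sum>m = 1..N. weight_prob (sum_list q) (q ! (m - 1))) = real N * query_prob N (sum_list q) p"
    using N_pos by (simp add: weight_prob_def query_prob_def)
  then show ?thesis
    using N_pos q by (simp add: pmf_query_eq_average pmf_cond_law)
qed

lemma set_query_subset: "set_pmf (map_pmf (query l) outcome_law) \<subseteq> query_set N l"
proof
  fix q assume "q \<in> set_pmf (map_pmf (query l) outcome_law)"
  then obtain m where "m \<in> {1..N}" "q \<in> set_pmf (cond_law l m)"
    unfolding map_query using N_pos by (auto simp: set_pmf_of_set)
  with set_cond_law show "q \<in> query_set N l"
    by blast
qed

lemma query_prob_nonneg: "0 \<le> query_prob N w p"
  using p_nonneg p_le_1 by (simp add: query_prob_def)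

lemma set_query:
  "set_pmf (map_pmf (query l) outcome_law) = {q \<in> query_set N l. query_prob N (sum_list q) p > 0}"
proof -
  have "q \<in> set_pmf (map_pmf (query l) outcome_law) \<longleftrightarrow> query_prob N (sum_list q) p > 0" if "q \<in> query_set N l" for q
    using pmf_query[OF that] query_prob_nonneg[of "sum_list q"] by (auto simp: set_pmf_iff simp del: set_map_pmf)
  with set_query_subset[of l] show ?thesis
    by blast
qed

section \<open>Rate, upload cost and access complexity\<close>

lemma expectation_query:
  fixes g :: "nat list \<Rightarrow> real"
  shows "measure_pmf.expectation outcome_law (\<lambda>\<omega>. g (query l \<omega>)) = (\<Sum>q\<in>query_set N l. query_prob N (sum_list q) p * g q)"
proof -
  have "measure_pmf.expectation outcome_law (\<lambda>\<omega>. g (query l \<omega>)) = measure_pmf.expectation (map_pmf (query l) outcome_law) g"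
    by simp
  also have "\<dots> = (\<Sum>q\<in>query_set N l. pmf (map_pmf (query l) outcome_law) q * g q)"
    using set_query_subset[of l] by (subst integral_measure_pmf[of "query_set N l"]) (auto simp del: integral_map_pmf)
  also have "\<dots> = (\<Sum>q\<in>query_set N l. query_prob N (sum_list q) p * g q)"
    by (simp add: pmf_query)
  finally show ?thesis .
qed

lemma sum_query_prob: "(\<Sum>q\<in>query_set N l. query_prob N (sum_list q) p) = 1"
  using expectation_query[where g = "\<lambda>_. 1"] by simp

lemma sum_bit_vectors_query_prob:
  "(\<Sum>q\<in>bit_vectors N. query_prob N (sum_list q) p * g (sum_list q))
    = (\<Sum>w = 0..N. real (N choose w) * (query_prob N w p * g w))"
  by (rule sum_bit_vectors_weight)

text \<open>Each server contributes total probability 1. Only the zero query costs nothing, and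
  having even weight it goes to server 1 alone, so the expected lengths add up to 2 minus its
  probability.\<close>

lemma rate_eq: "rate servers 1 bits bits outcome_law query answer_length = inverse (1 - (1 - p) ^ (N - 1) + 1)"
proof -
  let ?f = "\<lambda>q. query_prob N (sum_list q) p"
  have zero: "sum_list q = 0 \<longleftrightarrow> q = replicate N 0" if "q \<in> bit_vectors N" for q
    using that by (subst sum_list_eq_0_iff_replicate) (simp add: bit_vectors_def)
  have "(\<Sum>l\<in>servers. measure_pmf.expectation outcome_law (\<lambda>\<omega>. real (answer_length l (query l \<omega>))))
      = (\<Sum>l\<in>servers. \<Sum>q\<in>query_set N l. if sum_list q = 0 then 0 else ?f q)"
  proof (rule sum.cong)
    fix l
    show "measure_pmf.expectation outcome_law (\<lambda>\<omega>. real (answer_length l (query l \<omega>)))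
        = (\<Sum>q\<in>query_set N l. if sum_list q = 0 then 0 else ?f q)"
      unfolding expectation_query[of "\<lambda>q. real (answer_length l q)" l]
      by (rule sum.cong) (auto simp: answer_length_eq)
  qed simp
  also have "\<dots> = (\<Sum>q\<in>bit_vectors N. ?f q - (if q = replicate N 0 then ?f q else 0))"
    unfolding sum_servers_query_set by (intro sum.cong refl) (simp add: zero del: sum_list_eq_0_iff)
  also have "\<dots> = (\<Sum>q\<in>bit_vectors N. ?f q) - query_prob N 0 p"
  proof -
    have "replicate N 0 \<in> bit_vectors N"
      by (auto simp: bit_vectors_def)
    then show ?thesis
      by (simp add: sum_subtractf sum_list_replicate)
  qed
  also have "(\<Sum>q\<in>bit_vectors N. ?f q) = 2"
    by (simp add: sum_query_prob servers_def flip: sum_servers_query_set)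
  also have "query_prob N 0 p = (1 - p) ^ (N - 1)"
    using N_pos by (simp add: query_prob_def)
  finally show ?thesis
    by (simp add: rate_def bits_def divide_inverse)
qed

lemma entropy_query:
  "entropy_bits outcome_law (query l) = - (\<Sum>q\<in>query_set N l. xlog2 (query_prob N (sum_list q) p))"
  by (subst entropy_bits_eq_xlog2[OF finite_query_set set_query_subset]) (simp add: pmf_query)

lemma upload_cost_eq:
  "upload_cost servers outcome_law query
    = - (\<Sum>w = 0..N. real (N choose w) * query_prob N w p * log 2 (query_prob N w p))"
  by (simp add: upload_cost_def entropy_query sum_negf sum_servers_query_set xlog2_def mult.assoc
      sum_bit_vectors_query_prob[of "\<lambda>w. log 2 (query_prob N w p)"])

lemma access_complexity_eq:
  "access_complexity servers outcome_law query accessed_symbols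
    = (\<Sum>w = 0..N. real w * real (N choose w) * query_prob N w p)"
proof -
  have "access_complexity servers outcome_law query accessed_symbols
      = (\<Sum>l\<in>servers. \<Sum>q\<in>query_set N l. query_prob N (sum_list q) p * real (sum_list q))"
    unfolding access_complexity_def
    by (subst expectation_query) (auto simp: accessed_symbols_eq query_set_def bit_vectors_def intro!: sum.cong)
  then show ?thesis
    unfolding sum_servers_query_set sum_bit_vectors_query_prob[of real] by (simp add: mult_ac)
qed

section \<open>Mutual information leakage\<close>

lemma sum_xlog2_cond_law:
  assumes "m \<in> {1..N}"
  shows "(\<Sum>q\<in>query_set N l. xlog2 (pmf (cond_law l m) q)) = - (real N - 1) * binary_entropy p"
proof -
  have "(\<Sum>q\<in>query_set N l. xlog2 (pmf (cond_law l m) q)) = (\<Sum>s\<in>bit_vectors (N - 1). xlog2 (pmf vector_law s))"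
    unfolding sum.reindex_bij_betw[OF bij_query_vector[OF assms, of l], symmetric]
    using assms by (simp add: pmf_cond_law_query_vector)
  also have "\<dots> = - (real N - 1) * binary_entropy p"
    unfolding vector_law_def sum_xlog2_replicate_bit_pmf[OF p_nonneg p_le_1]
    using N_pos by (simp add: of_nat_diff)
  finally show ?thesis .
qed

text \<open>This is I(M;Q) = H(Q) - H(Q|M). Given any index, the query is a bijective image of the
  user vector and so has entropy (N - 1) times the binary entropy of p.\<close>

lemma mutual_information_query:
  "mutual_information_bits outcome_law index (query l)
    = entropy_bits outcome_law (query l) - (real N - 1) * binary_entropy p"
proof -
  let ?Z = "map_pmf (\<lambda>\<omega>. (index \<omega>, query l \<omega>)) outcome_law"
  let ?f = "pmf (map_pmf (query l) outcome_law)"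
  let ?K = "\<lambda>m. pmf (cond_law l m)"
  let ?t = "\<lambda>z. pmf ?Z z * log 2 (pmf ?Z z / (pmf (map_pmf index outcome_law) (fst z) * ?f (snd z)))"
  have N: "0 < real N"
    using N_pos by simp
  have sub: "set_pmf ?Z \<subseteq> {1..N} \<times> query_set N l"
  proof -
    have "set_pmf ?Z \<subseteq> set_pmf (map_pmf index outcome_law) \<times> set_pmf (map_pmf (query l) outcome_law)"
      by auto
    then show ?thesis
      using set_query_subset[of l] set_index by blast
  qed
  have summand: "?t (m, q) = (xlog2 (?K m q) - ?K m q * log 2 (?f q)) / real N"
    if m: "m \<in> {1..N}" and "q \<in> query_set N l" for m q
  proof (cases "?K m q = 0")
    case True
    then show ?thesis
      using pmf_index_query[OF m] by simp
  next
    case False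
    then have pos: "0 < ?K m q"
      by (simp add: pmf_pos)
    \<comment> \<open>The marginal is an average containing this positive term, so it is positive
      and the logarithm of the quotient splits.\<close>
    have "?K m q \<le> (\<Sum>m = 1..N. ?K m q)"
      using m by (intro member_le_sum) auto
    then have "0 < ?f q"
      using pos N by (simp add: pmf_query_eq_average)
    then have "log 2 (?K m q / ?f q) = log 2 (?K m q) - log 2 (?f q)"
      using pos by (simp add: log_divide)
    moreover have "?K m q / real N / (1 / real N * ?f q) = ?K m q / ?f q"
      using N by simp
    ultimately show ?thesis
      by (simp only: fst_conv snd_conv pmf_index_query[OF m] pmf_index[OF m]) (simp add: xlog2_def algebra_simps diff_divide_distrib)
  qed
  have "mutual_information_bits outcome_law index (query l) = (\<Sum>z\<in>set_pmf ?Z. ?t z)"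
    by (rule mutual_information_bits_eq_sum) (rule finite_subset[OF sub], simp)
  also have "\<dots> = (\<Sum>z\<in>{1..N} \<times> query_set N l. ?t z)"
    using sub by (intro sum.mono_neutral_left) (auto simp: set_pmf_iff simp del: set_map_pmf)
  also have "\<dots> = (\<Sum>m = 1..N. \<Sum>q\<in>query_set N l. ?t (m, q))"
    by (simp add: sum.cartesian_product case_prod_beta)
  also have "\<dots> = (\<Sum>m = 1..N. \<Sum>q\<in>query_set N l. (xlog2 (?K m q) - ?K m q * log 2 (?f q)) / real N)"
    by (intro sum.cong refl summand)
  also have "\<dots> = (\<Sum>m = 1..N. \<Sum>q\<in>query_set N l. xlog2 (?K m q)) / real N
      - (\<Sum>m = 1..N. \<Sum>q\<in>query_set N l. ?K m q * log 2 (?f q)) / real N"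
    by (simp add: sum_subtractf diff_divide_distrib flip: sum_divide_distrib)
  also have "(\<Sum>m = 1..N. \<Sum>q\<in>query_set N l. xlog2 (?K m q)) / real N = - (real N - 1) * binary_entropy p"
    using N by (simp add: sum_xlog2_cond_law)
  \<comment> \<open>The logarithm does not depend on \<open>m\<close>, so after exchanging the sums
    the average of the conditional laws becomes the marginal.\<close>
  also have "(\<Sum>m = 1..N. \<Sum>q\<in>query_set N l. ?K m q * log 2 (?f q)) / real N
      = (\<Sum>q\<in>query_set N l. (\<Sum>m = 1..N. ?K m q * log 2 (?f q)) / real N)"
    by (subst sum.swap) (rule sum_divide_distrib)
  also have "\<dots> = (\<Sum>q\<in>query_set N l. xlog2 (?f q))"
    by (simp add: xlog2_def pmf_query_eq_average flip: sum_distrib_right)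
  also have "\<dots> = - entropy_bits outcome_law (query l)"
    by (subst entropy_bits_eq_xlog2[OF finite_query_set set_query_subset]) simp
  finally show ?thesis
    by (simp add: algebra_simps)
qed

lemma leakage_MI_eq:
  "leakage_MI servers outcome_law index query
    = upload_cost servers outcome_law query / 2 - (real N - 1) * binary_entropy p"
  by (simp add: leakage_MI_def upload_cost_def mutual_information_query servers_def field_simps)

section \<open>Worst-case information leakage\<close>

lemma entropy_index: "entropy_bits outcome_law index = log 2 (real N)"
proof -
  have "entropy_bits outcome_law index = - (\<Sum>m = 1..N. xlog2 (pmf (map_pmf index outcome_law) m))"
    by (rule entropy_bits_eq_xlog2) (simp_all only: set_index finite_atLeastAtMost subset_refl)
  also have "(\<Sum>m = 1..N. xlog2 (pmf (map_pmf index outcome_law) m)) = - log 2 (real N)"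
    using N_pos by (simp add: pmf_index xlog2_def log_divide)
  finally show ?thesis
    by simp
qed

lemma entropy_index_law:
  assumes "w \<le> N" "query_prob N w p > 0"
  shows "entropy_bits (index_law N w p) id = - (real (N - w) * xlog2 (weight_prob w 0 / (real N * query_prob N w p))
    + real w * xlog2 (weight_prob w 1 / (real N * query_prob N w p)))"
proof -
  note pmf = pmf_index_law[OF p_nonneg p_le_1 assms]
  have sub: "set_pmf (map_pmf id (index_law N w p)) \<subseteq> {1..N}"
  proof
    fix m assume "m \<in> set_pmf (map_pmf id (index_law N w p))"
    then have "pmf (index_law N w p) m \<noteq> 0"
      by (simp add: set_pmf_iff)
    then show "m \<in> {1..N}"
      using \<open>w \<le> N\<close> by (auto simp: pmf split: if_splits)
  qed
  have union: "{1..N} = {1..N - w} \<union> {N - w + 1..N}"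
    using \<open>w \<le> N\<close> by auto
  have "entropy_bits (index_law N w p) id = - (\<Sum>m = 1..N. xlog2 (pmf (index_law N w p) m))"
    by (subst entropy_bits_eq_xlog2[OF _ sub]) simp_all
  also have "(\<Sum>m = 1..N. xlog2 (pmf (index_law N w p) m))
      = (\<Sum>m = 1..N - w. xlog2 (pmf (index_law N w p) m)) + (\<Sum>m = N - w + 1..N. xlog2 (pmf (index_law N w p) m))"
    unfolding union by (rule sum.union_disjoint) auto
  also have "(\<Sum>m = 1..N - w. xlog2 (pmf (index_law N w p) m))
      = (\<Sum>m = 1..N - w. xlog2 (weight_prob w 0 / (real N * query_prob N w p)))"
    by (rule sum.cong) (auto simp: pmf weight_prob_def)
  also have "(\<Sum>m = N - w + 1..N. xlog2 (pmf (index_law N w p) m))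
      = (\<Sum>m = N - w + 1..N. xlog2 (weight_prob w 1 / (real N * query_prob N w p)))"
    by (rule sum.cong) (auto simp: pmf weight_prob_def)
  finally show ?thesis
    using \<open>w \<le> N\<close> by (simp add: id_def)
qed

text \<open>By Bayes' rule with a uniform prior, the posterior of \<open>m\<close> depends only on
  the entry of \<open>q\<close> at \<open>m\<close>. It takes the same values as
  \<open>index_law\<close> with the same multiplicities, though in another order, and entropy
  ignores the order.\<close>

lemma entropy_given_query:
  assumes q: "q \<in> query_set N l" and pos: "query_prob N (sum_list q) p > 0"
  shows "entropy_given outcome_law index (query l) q = entropy_bits (index_law N (sum_list q) p) id"
proof -
  let ?A = "{\<omega>. query l \<omega> = q}"
  let ?C = "map_pmf index (cond_pmf outcome_law ?A)"
  let ?f = "query_prob N (sum_list q) p"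
  have len: "length q = N" "set q \<subseteq> {0, 1}"
    using q by (auto simp: query_set_def bit_vectors_def)
  have "q \<in> set_pmf (map_pmf (query l) outcome_law)"
    unfolding set_query using q pos by simp
  then have ne: "set_pmf outcome_law \<inter> ?A \<noteq> {}"
    by auto
  have prob_A: "measure_pmf.prob outcome_law ?A = ?f"
    using pmf_query[OF q] by (simp add: pmf_map vimage_def)
  have "pmf ?C m = weight_prob (sum_list q) (q ! (m - 1)) / (real N * ?f)" if m: "m \<in> {1..N}" for m
  proof -
    have "pmf ?C m = measure_pmf.prob outcome_law (?A \<inter> index -` {m}) / ?f"
      using emeasure_measure_pmf_not_zero[OF ne]
      by (simp add: pmf_map cond_pmf.rep_eq[OF ne] prob_A)
    also have "?A \<inter> index -` {m} = (\<lambda>\<omega>. (index \<omega>, query l \<omega>)) -` {(m, q)}"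
      by auto
    also have "measure_pmf.prob outcome_law \<dots> = weight_prob (sum_list q) (q ! (m - 1)) / real N"
      using pmf_index_query[OF m, of l q] pmf_cond_law[OF m q] by (simp add: pmf_map)
    finally show ?thesis
      by simp
  qed
  moreover have "set_pmf ?C \<subseteq> {1..N}"
  proof -
    have "set_pmf ?C \<subseteq> set_pmf (map_pmf index outcome_law)"
      using ne by auto
    then show ?thesis
      by (simp only: set_index)
  qed
  ultimately have "entropy_given outcome_law index (query l) q
      = - (\<Sum>m = 1..length q. xlog2 (weight_prob (sum_list q) (q ! (m - 1)) / (real N * ?f)))"
    unfolding entropy_given_def by (subst entropy_bits_eq_xlog2[of "{1..N}"]) (simp_all add: len)
  also have "\<dots> = entropy_bits (index_law N (sum_list q) p) id"
    using sum_list_bits_le[OF len(2)]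
    by (subst sum_over_bits[OF len(2)], subst entropy_index_law) (simp_all add: len pos)
  finally show ?thesis .
qed

lemma sum_list_image_bit_vectors: "sum_list ` bit_vectors n = {0..n}"
proof -
  have "w \<in> sum_list ` bit_vectors n" if "w \<le> n" for w
  proof (rule image_eqI)
    show "w = sum_list (replicate w 1 @ replicate (n - w) 0)"
      by (simp add: sum_list_replicate)
    show "replicate w 1 @ replicate (n - w) 0 \<in> bit_vectors n"
      using that by (auto simp: bit_vectors_def)
  qed
  then show ?thesis
    using sum_list_bit_vector_le by auto
qed

text \<open>The maximum over servers becomes a minimum over the union of the two supports. By parity
  this union contains every bit vector of positive \<open>query_prob\<close>, hence all weights over
  which the closed form minimizes.\<close>

lemma leakage_WIL_eq:
  "leakage_WIL servers outcome_law index query = log 2 (real N) -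
    (MIN w\<in>{w \<in> {0..N}. query_prob N w p > 0}. entropy_bits (index_law N w p) id)"
proof -
  let ?e = "\<lambda>w. entropy_bits (index_law N w p) id"
  let ?supp = "\<lambda>l. set_pmf (map_pmf (query l) outcome_law)"
  let ?H = "\<lambda>l. ?e ` sum_list ` ?supp l"
  have fin: "finite (?supp l)" for l
    using set_query_subset finite_query_set by (rule finite_subset)
  have ne: "?supp l \<noteq> {}" for l
    by (rule set_pmf_not_empty)
  have "(\<lambda>q. entropy_given outcome_law index (query l) q) ` ?supp l = ?H l" for l
    unfolding image_image by (rule image_cong) (auto simp: set_query entropy_given_query simp del: set_map_pmf)
  then have "leakage_WIL servers outcome_law index query = (MAX l\<in>servers. log 2 (real N) - Min (?H l))"
    by (simp only: leakage_WIL_def entropy_index)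
  also have "\<dots> = log 2 (real N) - min (Min (?H 1)) (Min (?H 2))"
    by (simp add: servers_def max_def min_def)
  also have "min (Min (?H 1)) (Min (?H 2)) = Min (?H 1 \<union> ?H 2)"
    using fin ne by (intro Min_Un[symmetric]) auto
  also have "?H 1 \<union> ?H 2 = ?e ` sum_list ` (?supp 1 \<union> ?supp 2)"
    by (simp only: image_Un)
  also have "sum_list ` (?supp 1 \<union> ?supp 2) = {w \<in> {0..N}. query_prob N w p > 0}"
  proof -
    have "?supp 1 \<union> ?supp 2 = {q \<in> bit_vectors N. query_prob N (sum_list q) p > 0}"
      unfolding set_query by (auto simp: query_set_def)
    then show ?thesis
      unfolding sum_list_image_bit_vectors[symmetric] by auto
  qed
  finally show ?thesis .
qed

section \<open>Maximal leakage\<close>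

definition max_weight_prob :: "nat \<Rightarrow> real" where
  "max_weight_prob w = (if w = 0 then (1 - p) ^ (N - 1) else (1 - p) ^ (N - w) * p ^ (w - 1))"

lemma cond_prob_query:
  assumes "m \<in> {1..N}"
  shows "\<P>(\<omega> in measure_pmf outcome_law. query l \<omega> = q \<bar> index \<omega> = m) = pmf (cond_law l m) q"
proof -
  have "{\<omega>. query l \<omega> = q \<and> index \<omega> = m} = (\<lambda>\<omega>. (index \<omega>, query l \<omega>)) -` {(m, q)}"
    by auto
  then have "measure_pmf.prob outcome_law {\<omega>. query l \<omega> = q \<and> index \<omega> = m} = pmf (cond_law l m) q / real N"
    using pmf_index_query[OF assms, of l q] by (simp add: pmf_map)
  moreover have "measure_pmf.prob outcome_law {\<omega>. index \<omega> = m} = 1 / real N"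
    using pmf_index[OF assms] by (simp add: pmf_map vimage_def)
  ultimately show ?thesis
    using N_pos by (simp add: cond_prob_def)
qed

text \<open>The hypotheses exclude the junk values. For positive weight, passing from entry 0 to
  entry 1 trades a factor p for 1 - p, which is at least as large since p is at most 1/2; at weight
  0 only entry 0 is possible.\<close>

lemma weight_prob_le_max:
  assumes "b = 0 \<Longrightarrow> w < N" "b \<noteq> 0 \<Longrightarrow> w \<noteq> 0"
  shows "weight_prob w b \<le> max_weight_prob w"
proof (cases "b = 0 \<and> w \<noteq> 0")
  case True
  then obtain k j where w: "w = Suc k" and j: "N - w = Suc j"
    using assms(1) by (metis Suc_diff_Suc not0_implies_Suc)
  have "((1 - p) ^ j * p ^ k) * p \<le> ((1 - p) ^ j * p ^ k) * (1 - p)"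
    using p_nonneg p_le_half by (intro mult_left_mono) auto
  moreover have "weight_prob w b = ((1 - p) ^ j * p ^ k) * p"
    using True j by (simp add: weight_prob_def w)
  moreover have "max_weight_prob w = ((1 - p) ^ j * p ^ k) * (1 - p)"
    unfolding max_weight_prob_def j using w by simp
  ultimately show ?thesis
    by simp
next
  case False
  with assms(2) show ?thesis
    by (auto simp: weight_prob_def max_weight_prob_def)
qed

lemma Max_cond_law:
  assumes q: "q \<in> query_set N l"
  shows "(MAX m\<in>{1..N}. pmf (cond_law l m) q) = max_weight_prob (sum_list q)"
proof (rule Max_eqI)
  have len: "length q = N" "set q \<subseteq> {0, 1}"
    using q by (auto simp: query_set_def bit_vectors_def)
  note K = pmf_cond_law[OF _ q]
  show "y \<le> max_weight_prob (sum_list q)" if y: "y \<in> (\<lambda>m. pmf (cond_law l m) q) ` {1..N}" for y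
  proof -
    obtain m where m: "m \<in> {1..N}" and y: "y = weight_prob (sum_list q) (q ! (m - 1))"
      using y K by auto
    have "m - 1 < length q"
      using m len(1) by auto
    \<comment> \<open>A zero entry forces weight below \<open>N\<close> and a nonzero entry forces
      positive weight, as \<open>weight_prob_le_max\<close> requires.\<close>
    then show ?thesis
      unfolding y using sum_list_bits_less[OF len(2)] elem_le_sum_list[of "m - 1" q] len(1)
      by (intro weight_prob_le_max) auto
  qed
  \<comment> \<open>The maximum is attained at index 1 for the zero query and at the position of any
    nonzero entry otherwise.\<close>
  show "max_weight_prob (sum_list q) \<in> (\<lambda>m. pmf (cond_law l m) q) ` {1..N}"
  proof (cases "sum_list q = 0")
    case True
    then have "q ! 0 = 0"
      using elem_le_sum_list[of 0 q] len N_pos by simp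
    then have "max_weight_prob (sum_list q) = pmf (cond_law l 1) q"
      using True N_pos by (simp add: K weight_prob_def max_weight_prob_def del: sum_list_eq_0_iff)
    then show ?thesis
      using N_pos by auto
  next
    case False
    then obtain j where j: "j < N" "q ! j \<noteq> 0"
      using len by (auto simp: in_set_conv_nth)
    then have "max_weight_prob (sum_list q) = pmf (cond_law l (Suc j)) q"
      using False by (simp add: K weight_prob_def max_weight_prob_def del: sum_list_eq_0_iff)
    then show ?thesis
      using j by auto
  qed
qed simp

text \<open>The parity condition is an indicator inside the sum, so both servers share one range of
  weights and their sums can be subtracted termwise.\<close>

definition max_prob_sum :: "nat \<Rightarrow> real" where
  "max_prob_sum l = (\<Sum>w = 0..N. real (N choose w) * (if odd (w + l) then max_weight_prob w else 0))"

lemma sum_Max_cond_prob: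
  "(\<Sum>q\<in>set_pmf (map_pmf (query l) outcome_law). MAX m\<in>set_pmf (map_pmf index outcome_law).
     \<P>(\<omega> in measure_pmf outcome_law. query l \<omega> = q \<bar> index \<omega> = m)) = max_prob_sum l"
proof -
  have Max: "(MAX m\<in>{1..N}. \<P>(\<omega> in measure_pmf outcome_law. query l \<omega> = q \<bar> index \<omega> = m)) = max_weight_prob (sum_list q)"
    if "q \<in> query_set N l" for q
  proof -
    have "(\<lambda>m. \<P>(\<omega> in measure_pmf outcome_law. query l \<omega> = q \<bar> index \<omega> = m)) ` {1..N} = (\<lambda>m. pmf (cond_law l m) q) ` {1..N}"
      by (intro image_cong refl cond_prob_query)
    then show ?thesis
      using Max_cond_law[OF that] by (simp only:)
  qed
  \<comment> \<open>Outside the support all conditional probabilities vanish, so the sum extends to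
    all of \<open>query_set\<close> even at p = 0.\<close>
  have zero: "max_weight_prob (sum_list q) = 0"
    if q: "q \<in> query_set N l" "q \<notin> set_pmf (map_pmf (query l) outcome_law)" for q
  proof -
    have "(\<Sum>m = 1..N. pmf (cond_law l m) q) = 0"
      using q(2) N_pos by (simp add: set_pmf_iff pmf_query_eq_average del: set_map_pmf)
    then have "pmf (cond_law l m) q = 0" if "m \<in> {1..N}" for m
      using that by (subst (asm) sum_nonneg_eq_0_iff) auto
    then have "(\<lambda>m. pmf (cond_law l m) q) ` {1..N} = (\<lambda>_. 0) ` {1..N}"
      by (intro image_cong refl)
    then have "(MAX m\<in>{1..N}. pmf (cond_law l m) q) = 0"
      using N_pos by simp
    then show ?thesis
      using Max_cond_law[OF q(1)] by simp
  qed
  have "(\<Sum>q\<in>set_pmf (map_pmf (query l) outcome_law). MAX m\<in>{1..N}.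
      \<P>(\<omega> in measure_pmf outcome_law. query l \<omega> = q \<bar> index \<omega> = m))
      = (\<Sum>q\<in>set_pmf (map_pmf (query l) outcome_law). max_weight_prob (sum_list q))"
    using set_query_subset[of l] by (intro sum.cong Max) auto
  also have "\<dots> = (\<Sum>q\<in>query_set N l. max_weight_prob (sum_list q))"
    using set_query_subset[of l] zero by (intro sum.mono_neutral_left) auto
  also have "\<dots> = (\<Sum>q\<in>bit_vectors N. if odd (sum_list q + l) then max_weight_prob (sum_list q) else 0)"
    unfolding query_set_def by (rule sum.inter_filter) simp
  also have "\<dots> = max_prob_sum l"
    unfolding max_prob_sum_def by (rule sum_bit_vectors_weight)
  finally show ?thesis
    by (simp only: set_index)
qed

lemma max_weight_prob_nonneg: "0 \<le> max_weight_prob w"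
  using p_nonneg p_le_1 by (simp add: max_weight_prob_def)

text \<open>Positivity allows the two logarithms to be compared through their arguments. The term at
  weight 0 suffices, as p < 1.\<close>

lemma max_prob_sum_pos: "0 < max_prob_sum 1"
proof -
  have "0 < (1 - p) ^ (N - 1)"
    using p_le_half by simp
  also have "\<dots> = real (N choose 0) * (if odd (0 + 1 :: nat) then max_weight_prob 0 else 0)"
    by (simp add: max_weight_prob_def)
  also have "\<dots> \<le> max_prob_sum 1"
    unfolding max_prob_sum_def by (rule member_le_sum) (auto simp: max_weight_prob_nonneg)
  finally show ?thesis .
qed

text \<open>Multiplying the difference by p turns the exponent w - 1 into w and leaves an
  alternating binomial sum. This requires p > 0, so p = 0 is settled by hand.\<close>

lemma max_prob_sum_le: "max_prob_sum 1 \<le> max_prob_sum 2"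
proof (cases "p = 0")
  case True
  \<comment> \<open>As 0^0 = 1, exactly the weights 0 and 1 survive: the sum is 1 for server 1 and
    \<open>N\<close> for server 2.\<close>
  have c: "max_weight_prob w = (if w \<le> 1 then 1 else 0)" for w
    unfolding max_weight_prob_def using True by (auto simp: power_0_left)
  have "max_prob_sum 1 = (\<Sum>w = 0..N. if w = 0 then 1 else 0)"
    unfolding max_prob_sum_def by (rule sum.cong) (auto simp: c le_Suc_eq)
  also have "\<dots> \<le> real (N choose 1) * (if odd (1 + 2 :: nat) then max_weight_prob 1 else 0)"
    using N_pos by (simp add: c)
  also have "\<dots> \<le> max_prob_sum 2"
    unfolding max_prob_sum_def using N_pos by (intro member_le_sum) (auto simp: c)
  finally show ?thesis .
next
  case False
  then have p: "0 < p"
    using p_nonneg by simp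
  \<comment> \<open>Up to its term at \<open>w = 0\<close>, this is the binomial expansion of \<open>(- p + (1 - p)) ^ N\<close>.\<close>
  have "p * (max_prob_sum 1 - max_prob_sum 2) = (\<Sum>w = 0..N. real (N choose w) * (-1) ^ w * (p * max_weight_prob w))"
    unfolding max_prob_sum_def sum_subtractf[symmetric] sum_distrib_left
    by (rule sum.cong) auto
  also have "\<dots> = (\<Sum>w = 0..N. real (N choose w) * (- p) ^ w * (1 - p) ^ (N - w)
      + (if w = 0 then p * (1 - p) ^ (N - 1) - (1 - p) ^ N else 0))"
  proof (rule sum.cong)
    fix w
    show "real (N choose w) * (-1) ^ w * (p * max_weight_prob w) = real (N choose w) * (- p) ^ w * (1 - p) ^ (N - w)
      + (if w = 0 then p * (1 - p) ^ (N - 1) - (1 - p) ^ N else 0)"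
      by (cases w) (auto simp: max_weight_prob_def power_minus[of p] mult_ac)
  qed simp
  also have "\<dots> = (1 - 2 * p) ^ N + p * (1 - p) ^ (N - 1) - (1 - p) ^ N"
    using binomial_ring[of "- p" "1 - p" N] by (simp add: sum.distrib atLeast0AtMost)
  \<comment> \<open>With N = n + 1 the expression equals (1 - 2p) ((1 - 2p)^n - (1 - p)^n), where
    the first factor is nonnegative and the second is not positive.\<close>
  also have "\<dots> \<le> 0"
  proof -
    obtain n where n: "N = Suc n"
      using N_pos by (cases N) auto
    have "(1 - 2 * p) ^ n \<le> (1 - p) ^ n"
      using p_le_half p_nonneg by (intro power_mono) auto
    then have "(1 - 2 * p) * (1 - 2 * p) ^ n \<le> (1 - 2 * p) * (1 - p) ^ n"
      using p_le_half by (intro mult_left_mono) auto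
    then show ?thesis
      by (simp add: n algebra_simps)
  qed
  finally show ?thesis
    using p by (simp add: mult_le_0_iff)
qed

text \<open>Server 2 attains the maximum. Its weights are odd, so the exceptional case of
  \<open>max_weight_prob\<close> at weight 0 never enters.\<close>

lemma leakage_MaxL_eq:
  "leakage_MaxL servers outcome_law index query =
    log 2 (\<Sum>w\<in>{w \<in> {1..N}. odd w}. real (N choose w) * (1 - p) ^ (N - w) * p ^ (w - 1))"
proof -
  have "leakage_MaxL servers outcome_law index query = (MAX l\<in>servers. log 2 (max_prob_sum l))"
    unfolding leakage_MaxL_def sum_Max_cond_prob ..
  also have "\<dots> = log 2 (max_prob_sum 2)"
    using max_prob_sum_pos max_prob_sum_le by (simp add: servers_def max_def)
  also have "max_prob_sum 2 = (\<Sum>w\<in>{w \<in> {1..N}. odd w}. real (N choose w) * (1 - p) ^ (N - w) * p ^ (w - 1))"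
    unfolding max_prob_sum_def
    by (rule sum.mono_neutral_cong_right) (auto simp: max_weight_prob_def Suc_le_eq odd_pos)
  finally show ?thesis .
qed

end

theorem theorem3:
  fixes N :: nat and p :: real
  assumes "1 \<le> N" and "0 \<le> p" and "p \<le> 1 / 2"
  defines "P \<equiv> scheme_space N (replicate_pmf (N - 1) (bit_pmf p))"
  defines "U \<equiv> - (\<Sum>w = 0..N. real (N choose w) * query_prob N w p * log 2 (query_prob N w p))"
  shows "rate servers 1 bits bits P query answer_length = inverse (1 - (1 - p) ^ (N - 1) + 1)
    \<and> upload_cost servers P query = U
    \<and> access_complexity servers P query accessed_symbols =
           (\<Sum>w = 0..N. real w * real (N choose w) * query_prob N w p)
    \<and> leakage_MI servers P index query = U / 2 - (real N - 1) * binary_entropy p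
    \<and> leakage_WIL servers P index query =
           log 2 (real N) -
             (MIN w\<in>{w \<in> {0..N}. query_prob N w p > 0}. entropy_bits (index_law N w p) id)
    \<and> leakage_MaxL servers P index query =
           log 2 (\<Sum>w\<in>{w \<in> {1..N}. odd w}. real (N choose w) * (1 - p) ^ (N - w) * p ^ (w - 1))"
proof -
  interpret bernoulli_scheme N p
    using assms(1-3) by unfold_locales
  have P: "P = outcome_law"
    by (simp add: P_def outcome_law_def vector_law_def)
  show ?thesis
    unfolding P U_def
    by (intro conjI rate_eq upload_cost_eq access_complexity_eq leakage_WIL_eq leakage_MaxL_eq
        leakage_MI_eq[unfolded upload_cost_eq])
qed

end
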